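(* If a cartesian multicategory $\mathcal M$ is representable, then the category $\mathcal M_-$ has finite products. If a cartesian multicategory $\mathcal M$ has algebraic products (of all finite families of objects), then it is representable. Any functor $F:\mathcal M\to\mathcal N$ in $\mathbf{fpMlt}$ preserves the algebraic products, the preuniversal arrows and the universal products that exist in $\mathcal M$.
   Context: A cartesian structure on a multicategory $\mathcal M$ assigns, to every mapping $\sigma:\{1,\dots,n\}\to\{1,\dots,m\}$ and sequences of objects $A_1,\dots,A_n$ and $B_1,\dots,B_m$ with $B_{\sigma i}=A_i$, and every object $C$, a mapping $f\mapsto\sigma f$, $\mathcal M(A_1,\dots,A_n;C)\to\mathcal M(B_1,\dots,B_m;C)$, functorially ($\mathrm{id}f=f$, $\rho(\sigma f)=(\rho\sigma)f$) and compatibly with composition: (i) $f(\sigma_1f_1,\dots,\sigma_nf_n)=(\sigma_1+\cdots+\sigma_n)f(f_1,\dots,f_n)$, where $+$ is juxtaposition of mappings; (ii) $(\sigma f)(f_1,\dots,f_m)=\sigma'\big(f(f_{\sigma1},\dots,f_{\sigma n})\big)$, where $\sigma'$ maps the $k$-th place of the $i$-th block (the domain of $f_{\sigma i}$) to the $k$-th place of the $(\sigma i)$-th block of the concatenated domains of $f_1,\dots,f_m$. A cartesian multicategory is a multicategory with a cartesian structure; $\mathbf{fpMlt}$ is the category of cartesian multicategories and functors preserving the actions, $F(\sigma f)=\sigma(Ff)$. $\mathcal M_-$ is the category of objects and unary arrows of $\mathcal M$. An algebraic product of $A_1,\dots,A_n$ ($n\ge0$) is an object $C$ with arrows $p_i:C\to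 A_i$ and $u:A_1,\dots,A_n\to C$ such that $\gamma\big(u(p_1,\dots,p_n)\big)=\mathrm{id}_C$, where $\gamma:\mathcal M(C,\dots,C;C)\to\mathcal M(C;C)$ is the action of the unique map $\{1,\dots,n\}\to\{1\}$, and $p_i\,u=\iota_i\,\mathrm{id}_{A_i}$ for each $i$, where $\iota_i:\mathcal M(A_i;A_i)\to\mathcal M(A_1,\dots,A_n;A_i)$ is the action of the map $\{1\}\to\{1,\dots,n\}$, $1\mapsto i$. A universal product of $A_1,\dots,A_n$ is an object $C$ with arrows $p_i:C\to A_i$ such that for every sequence $X_1,\dots,X_k$ ($k\ge 0$) and arrows $f_i:X_1,\dots,X_k\to A_i$ ($1\le i\le n$) there is a unique $t:X_1,\dots,X_k\to C$ with $p_it=f_i$ for all $i$. An arrow $u:A_1,\dots,A_n\to C$ is preuniversal if composition with $u$ gives a bijection $\mathcal M(C;B)\to\mathcal M(A_1,\dots,A_n;B)$ for every object $B$. $\mathcal M$ is representable if every finite sequence of objects is the domain of a preuniversal arrow and preuniversal arrows are closed under composition. *)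

theory Defs
  imports Main
begin

record ('o, 'a) cat =
  cobj :: "'o set"
  carr :: "'a set"
  cdom :: "'a \<Rightarrow> 'o"
  ccod :: "'a \<Rightarrow> 'o"
  cid :: "'o \<Rightarrow> 'a"
  ccomp :: "'a \<Rightarrow> 'a \<Rightarrow> 'a"

definition chom :: "('o, 'a, 'x) cat_scheme \<Rightarrow> 'o \<Rightarrow> 'o \<Rightarrow> 'a set" where
  "chom K A B = {f \<in> carr K. cdom K f = A \<and> ccod K f = B}"

locale category =
  fixes K :: "('o, 'a, 'x) cat_scheme"
  assumes arr_obj: "f \<in> carr K \<Longrightarrow> cdom K f \<in> cobj K \<and> ccod K f \<in> cobj K"
    and id_hom: "A \<in> cobj K \<Longrightarrow> cid K A \<in> chom K A A"
    and comp_hom: "g \<in> chom K B C \<Longrightarrow> f \<in> chom K A B \<Longrightarrow> ccomp K g f \<in> chom K A C"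
    and id_left: "f \<in> chom K A B \<Longrightarrow> ccomp K (cid K B) f = f"
    and id_right: "f \<in> chom K A B \<Longrightarrow> ccomp K f (cid K A) = f"
    and assoc: "h \<in> chom K C D \<Longrightarrow> g \<in> chom K B C \<Longrightarrow> f \<in> chom K A B \<Longrightarrow>
      ccomp K (ccomp K h g) f = ccomp K h (ccomp K g f)"

definition cat_product ::
  "('o, 'a, 'x) cat_scheme \<Rightarrow> 'o list \<Rightarrow> 'o \<Rightarrow> 'a list \<Rightarrow> bool" where
  "cat_product K As P ps \<longleftrightarrow>
     P \<in> cobj K \<and> length ps = length As \<and>
     (\<forall>i<length As. ps ! i \<in> chom K P (As ! i)) \<and>
     (\<forall>X\<in>cobj K. \<forall>fs. length fs = length As \<and> (\<forall>i<length As. fs ! i \<in> chom K X (As ! i)) \<longrightarrow>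
       (\<exists>!t. t \<in> chom K X P \<and> (\<forall>i<length As. ccomp K (ps ! i) t = fs ! i)))"

definition has_finite_products :: "('o, 'a, 'x) cat_scheme \<Rightarrow> bool" where
  "has_finite_products K \<longleftrightarrow> (\<forall>As. set As \<subseteq> cobj K \<longrightarrow> (\<exists>P ps. cat_product K As P ps))"

text \<open>The hom-sets of a multicategory are presented as a single set of arrows, each with a
  source (a list of objects) and a target; \<open>comp M f [f\<^sub>1, \<dots>, f\<^sub>n]\<close> is \<open>f(f\<^sub>1, \<dots>, f\<^sub>n)\<close>.\<close>

record ('o, 'a) multicat =
  obj :: "'o set"
  arr :: "'a set"
  src :: "'a \<Rightarrow> 'o list"
  tgt :: "'a \<Rightarrow> 'o"
  ident :: "'o \<Rightarrow> 'a"
  comp :: "'a \<Rightarrow> 'a list \<Rightarrow> 'a"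

definition hom :: "('o, 'a, 'x) multicat_scheme \<Rightarrow> 'o list \<Rightarrow> 'o \<Rightarrow> 'a set" where
  "hom M As B = {f \<in> arr M. src M f = As \<and> tgt M f = B}"

definition composable :: "('o, 'a, 'x) multicat_scheme \<Rightarrow> 'a \<Rightarrow> 'a list \<Rightarrow> bool" where
  "composable M f fs \<longleftrightarrow> f \<in> arr M \<and> set fs \<subseteq> arr M \<and> map (tgt M) fs = src M f"

locale multicategory =
  fixes M :: "('o, 'a, 'x) multicat_scheme"
  assumes src_obj: "f \<in> arr M \<Longrightarrow> set (src M f) \<subseteq> obj M"
    and tgt_obj: "f \<in> arr M \<Longrightarrow> tgt M f \<in> obj M"
    and ident_hom: "A \<in> obj M \<Longrightarrow> ident M A \<in> hom M [A] A"
    and comp_hom: "composable M f fs \<Longrightarrow> comp M f fs \<in> hom M (concat (map (src M) fs)) (tgt M f)"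
    and comp_ident_left: "f \<in> arr M \<Longrightarrow> comp M (ident M (tgt M f)) [f] = f"
    and comp_ident_right: "f \<in> arr M \<Longrightarrow> comp M f (map (ident M) (src M f)) = f"
    and comp_assoc:
      "composable M f fs \<Longrightarrow> length gss = length fs \<Longrightarrow>
       (\<And>i. i < length fs \<Longrightarrow> composable M (fs ! i) (gss ! i)) \<Longrightarrow>
       comp M (comp M f fs) (concat gss) = comp M f (map2 (comp M) fs gss)"

definition unary_category :: "('o, 'a, 'x) multicat_scheme \<Rightarrow> ('o, 'a) cat" where
  "unary_category M =
    \<lparr> cobj = obj M,
      carr = {f \<in> arr M. length (src M f) = 1},
      cdom = (\<lambda>f. hd (src M f)),
      ccod = tgt M,
      cid = ident M,
      ccomp = (\<lambda>g f. comp M g [f]) \<rparr>"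

lemma chom_unary_category: "chom (unary_category M) A B = hom M [A] B"
  by (auto simp: chom_def hom_def unary_category_def length_Suc_conv)

lemma (in multicategory) category_unary_category: "category (unary_category M)"
proof
  fix f assume "f \<in> carr (unary_category M)"
  then have f: "f \<in> arr M" "length (src M f) = 1"
    by (auto simp: unary_category_def)
  then show "cdom (unary_category M) f \<in> cobj (unary_category M) \<and>
      ccod (unary_category M) f \<in> cobj (unary_category M)"
    using src_obj[OF f(1)] tgt_obj[OF f(1)]
    by (auto simp: unary_category_def length_Suc_conv)
next
  fix A assume "A \<in> cobj (unary_category M)"
  then show "cid (unary_category M) A \<in> chom (unary_category M) A A"
    unfolding chom_unary_category using ident_hom by (simp add: unary_category_def)
next
  fix g f A B C
  assume "g \<in> chom (unary_category M) B C" "f \<in> chom (unary_category M) A B"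
  then show "ccomp (unary_category M) g f \<in> chom (unary_category M) A C"
    unfolding chom_unary_category using comp_hom[of g "[f]"]
    by (auto simp: unary_category_def hom_def composable_def)
next
  fix f A B assume "f \<in> chom (unary_category M) A B"
  then show "ccomp (unary_category M) (cid (unary_category M) B) f = f"
    unfolding chom_unary_category using comp_ident_left[of f]
    by (auto simp: unary_category_def hom_def)
next
  fix f A B assume "f \<in> chom (unary_category M) A B"
  then show "ccomp (unary_category M) f (cid (unary_category M) A) = f"
    unfolding chom_unary_category using comp_ident_right[of f]
    by (auto simp: unary_category_def hom_def)
next
  fix h g f A B C D
  assume "h \<in> chom (unary_category M) C D" "g \<in> chom (unary_category M) B C"
    "f \<in> chom (unary_category M) A B"
  then show "ccomp (unary_category M) (ccomp (unary_category M) h g) f =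
      ccomp (unary_category M) h (ccomp (unary_category M) g f)"
    unfolding chom_unary_category using comp_assoc[of h "[g]" "[[f]]"]
    by (auto simp: unary_category_def hom_def composable_def)
qed

definition preuniversal :: "('o, 'a, 'x) multicat_scheme \<Rightarrow> 'a \<Rightarrow> bool" where
  "preuniversal M u \<longleftrightarrow>
     u \<in> arr M \<and>
     (\<forall>B\<in>obj M. bij_betw (\<lambda>f. comp M f [u]) (hom M [tgt M u] B) (hom M (src M u) B))"

definition representable :: "('o, 'a, 'x) multicat_scheme \<Rightarrow> bool" where
  "representable M \<longleftrightarrow>
     (\<forall>As. set As \<subseteq> obj M \<longrightarrow> (\<exists>u. src M u = As \<and> preuniversal M u)) \<and>
     (\<forall>u us. preuniversal M u \<and> (\<forall>v\<in>set us. preuniversal M v) \<and> map (tgt M) us = src M u \<longrightarrow>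
       preuniversal M (comp M u us))"

definition universal_product ::
  "('o, 'a, 'x) multicat_scheme \<Rightarrow> 'o list \<Rightarrow> 'o \<Rightarrow> 'a list \<Rightarrow> bool" where
  "universal_product M As C ps \<longleftrightarrow>
     C \<in> obj M \<and> length ps = length As \<and>
     (\<forall>i<length As. ps ! i \<in> hom M [C] (As ! i)) \<and>
     (\<forall>Xs fs. set Xs \<subseteq> obj M \<and> length fs = length As \<and>
         (\<forall>i<length As. fs ! i \<in> hom M Xs (As ! i)) \<longrightarrow>
       (\<exists>!t. t \<in> hom M Xs C \<and> (\<forall>i<length As. comp M (ps ! i) [t] = fs ! i)))"

text \<open>A mapping \<open>\<sigma> : {1,\<dots>,n} \<rightarrow> {1,\<dots>,m}\<close> is encoded, with indices starting from 0, as the list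
  \<open>[\<sigma> 0, \<dots>, \<sigma> (n-1)]\<close> of numbers below \<open>m\<close>. The value of \<open>m\<close> is not part of the list; the
  action receives it through the new source \<open>Bs\<close>, of length \<open>m\<close>.
  Thus \<open>[0..<n]\<close> is the identity and \<open>map ((!) \<rho>) \<sigma>\<close> is the composite \<open>\<rho>\<sigma>\<close>.\<close>

definition reindexing :: "nat list \<Rightarrow> 'o list \<Rightarrow> 'o list \<Rightarrow> bool" where
  "reindexing \<sigma> As Bs \<longleftrightarrow> set \<sigma> \<subseteq> {..<length Bs} \<and> map ((!) Bs) \<sigma> = As"

text \<open>\<open>juxtapose \<sigma>s ms\<close> is \<open>\<sigma>\<^sub>1 + \<dots> + \<sigma>\<^sub>n\<close>, where \<open>ms\<close> lists the sizes of the codomains.\<close>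

definition juxtapose :: "nat list list \<Rightarrow> nat list \<Rightarrow> nat list" where
  "juxtapose \<sigma>s ms =
     concat (map (\<lambda>i. map (\<lambda>k. sum_list (take i ms) + k) (\<sigma>s ! i)) [0..<length \<sigma>s])"

text \<open>For consecutive blocks of sizes \<open>ms\<close>, the mapping \<open>\<sigma>'\<close> whose \<open>i\<close>-th block runs
  identically through the \<open>\<sigma> i\<close>-th block.\<close>

definition block_mapping :: "nat list \<Rightarrow> nat list \<Rightarrow> nat list" where
  "block_mapping \<sigma> ms =
     concat (map (\<lambda>j. map (\<lambda>k. sum_list (take j ms) + k) [0..<ms ! j]) \<sigma>)"

text \<open>\<open>act M \<sigma> Bs f\<close> is \<open>\<sigma>f\<close>, with source \<open>Bs\<close>.\<close>

record ('o, 'a) cart_multicat = "('o, 'a) multicat" +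
  act :: "nat list \<Rightarrow> 'o list \<Rightarrow> 'a \<Rightarrow> 'a"

locale cartesian_multicategory = multicategory M
  for M :: "('o, 'a, 'x) cart_multicat_scheme" +
  assumes act_hom:
      "f \<in> hom M As C \<Longrightarrow> set Bs \<subseteq> obj M \<Longrightarrow> reindexing \<sigma> As Bs \<Longrightarrow> act M \<sigma> Bs f \<in> hom M Bs C"
    and act_id:
      "f \<in> hom M As C \<Longrightarrow> act M [0..<length As] As f = f"
    and act_act:
      "f \<in> hom M As D \<Longrightarrow> set Bs \<subseteq> obj M \<Longrightarrow> set Cs \<subseteq> obj M \<Longrightarrow>
       reindexing \<sigma> As Bs \<Longrightarrow> reindexing \<rho> Bs Cs \<Longrightarrow>
       act M \<rho> Cs (act M \<sigma> Bs f) = act M (map ((!) \<rho>) \<sigma>) Cs f"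
    and comp_act_right:
      "composable M f fs \<Longrightarrow> length \<sigma>s = length fs \<Longrightarrow> length Bss = length fs \<Longrightarrow>
       (\<And>i. i < length fs \<Longrightarrow>
          set (Bss ! i) \<subseteq> obj M \<and> reindexing (\<sigma>s ! i) (src M (fs ! i)) (Bss ! i)) \<Longrightarrow>
       comp M f (map (\<lambda>i. act M (\<sigma>s ! i) (Bss ! i) (fs ! i)) [0..<length fs]) =
       act M (juxtapose \<sigma>s (map length Bss)) (concat Bss) (comp M f fs)"
    and comp_act_left:
      "f \<in> arr M \<Longrightarrow> set fs \<subseteq> arr M \<Longrightarrow> reindexing \<sigma> (src M f) (map (tgt M) fs) \<Longrightarrow>
       comp M (act M \<sigma> (map (tgt M) fs) f) fs =
       act M (block_mapping \<sigma> (map (\<lambda>g. length (src M g)) fs)) (concat (map (src M) fs))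
         (comp M f (map ((!) fs) \<sigma>))"

locale cartesian_functor =
  M: cartesian_multicategory M + N: cartesian_multicategory N
  for M :: "('o, 'a, 'x) cart_multicat_scheme" and N :: "('p, 'b, 'y) cart_multicat_scheme" +
  fixes F\<^sub>o :: "'o \<Rightarrow> 'p" and F\<^sub>a :: "'a \<Rightarrow> 'b"
  assumes F_obj: "A \<in> obj M \<Longrightarrow> F\<^sub>o A \<in> obj N"
    and F_hom: "f \<in> hom M As B \<Longrightarrow> F\<^sub>a f \<in> hom N (map F\<^sub>o As) (F\<^sub>o B)"
    and F_ident: "A \<in> obj M \<Longrightarrow> F\<^sub>a (ident M A) = ident N (F\<^sub>o A)"
    and F_comp: "composable M f fs \<Longrightarrow> F\<^sub>a (comp M f fs) = comp N (F\<^sub>a f) (map F\<^sub>a fs)"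
    and F_act:
      "f \<in> hom M As C \<Longrightarrow> set Bs \<subseteq> obj M \<Longrightarrow> reindexing \<sigma> As Bs \<Longrightarrow>
       F\<^sub>a (act M \<sigma> Bs f) = act N \<sigma> (map F\<^sub>o Bs) (F\<^sub>a f)"

definition algebraic_product ::
  "('o, 'a, 'x) cart_multicat_scheme \<Rightarrow> 'o list \<Rightarrow> 'o \<Rightarrow> 'a list \<Rightarrow> 'a \<Rightarrow> bool" where
  "algebraic_product M As C ps u \<longleftrightarrow>
     C \<in> obj M \<and> length ps = length As \<and>
     (\<forall>i<length As. ps ! i \<in> hom M [C] (As ! i)) \<and>
     u \<in> hom M As C \<and>
     act M (replicate (length As) 0) [C] (comp M u ps) = ident M C \<and>
     (\<forall>i<length As. comp M (ps ! i) [u] = act M [i] As (ident M (As ! i)))"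

definition has_algebraic_products :: "('o, 'a, 'x) cart_multicat_scheme \<Rightarrow> bool" where
  "has_algebraic_products M \<longleftrightarrow>
     (\<forall>As. set As \<subseteq> obj M \<longrightarrow> (\<exists>C ps u. algebraic_product M As C ps u))"

end

(* Projections p_i of u : A_1, ..., A_n -> C are arrows with p_i u = iota_i id. If arrows v_1, ..., v_m
   have projections q_ij, then g |-> gamma (g(q_11, ..., q_mn)) is a right inverse of f |-> f(v_1, ..., v_m),
   gamma contracting each block to one place; it is a left inverse too when gamma (v_i(q_i1, ...)) = id.
   So algebraic products are preuniversal and so are their composites. Conversely, if u is preuniversal,
   the p_i exist, and gamma (u(p_1, ..., p_n)) = id because both sides agree after composition with u.
   Likewise, contracting u(f_1, ..., f_n) along X_1, ..., X_k turns an algebraic product into a universal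
   one, and a universal one determines u. Hence all three notions are equivalent to the equational one,
   which every functor preserves. *)

theory Submission imports Defs begin

section \<open>Reindexings of concatenated lists\<close>

text \<open>The first \<open>k\<close> blocks occupy
  \<open>sum_list (map length (take k xss))\<close> places, which is the offset that
  \<open>juxtapose\<close> and \<open>block_mapping\<close> add. A flat index is thus turned back
  into a block and a place in it.\<close>

lemma nth_concat:
  "k < length xss \<Longrightarrow> j < length (xss ! k) \<Longrightarrow>
     concat xss ! (sum_list (map length (take k xss)) + j) = xss ! k ! j"
proof (induction xss arbitrary: k)
  case (Cons xs xss)
  then show ?case
    by (cases k) (auto simp: nth_append add.assoc)
qed simp

lemma nth_concat_bound:
  "k < length xss \<Longrightarrow> j < length (xss ! k) \<Longrightarrow>
     sum_list (map length (take k xss)) + j < length (concat xss)"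
proof (induction xss arbitrary: k)
  case (Cons xs xss)
  then show ?case
    by (cases k) (auto simp: add.assoc)
qed simp

text \<open>The shift applied to \<open>\<sigma>s ! i\<close> is the offset of the
  \<open>i\<close>-th block in \<open>concat Bss\<close>, so every lookup stays inside
  \<open>Bss ! i\<close>. This supplies a side condition for merging successive actions.\<close>

lemma reindexing_juxtapose:
  assumes "length \<sigma>s = length Ass" "length Bss = length Ass"
    and "\<And>i. i < length Ass \<Longrightarrow> reindexing (\<sigma>s ! i) (Ass ! i) (Bss ! i)"
  shows "reindexing (juxtapose \<sigma>s (map length Bss)) (concat Ass) (concat Bss)"
proof -
  have bound: "j < length (Bss ! i)" if "i < length Ass" "j \<in> set (\<sigma>s ! i)" for i j
    using assms(3)[OF that(1)] that(2) by (auto simp: reindexing_def)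
  have "set (juxtapose \<sigma>s (map length Bss)) \<subseteq> {..<length (concat Bss)}"
    using nth_concat_bound[of _ Bss] bound assms(1,2)
    by (auto simp: juxtapose_def take_map simp del: length_concat)
  moreover have "map ((!) (concat Bss)) (juxtapose \<sigma>s (map length Bss)) =
      concat (map (\<lambda>i. map ((!) (Bss ! i)) (\<sigma>s ! i)) [0..<length Ass])"
    using bound assms(1,2)
    by (auto simp: juxtapose_def map_concat take_map nth_concat intro!: arg_cong[of _ _ concat])
  moreover have "map (\<lambda>i. map ((!) (Bss ! i)) (\<sigma>s ! i)) [0..<length Ass] = Ass"
    using assms(3) by (auto simp: reindexing_def intro: nth_equalityI)
  ultimately show ?thesis
    by (simp add: reindexing_def)
qed

text \<open>Each chosen block is copied place by place, so lookup returns the blocks selected by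
  \<open>\<sigma>\<close>. The entries are arbitrary: when they are indices instead of objects, the
  lookup equation computes a composite of mappings.\<close>

lemma reindexing_block_mapping:
  assumes "set \<sigma> \<subseteq> {..<length Ass}"
  shows "reindexing (block_mapping \<sigma> (map length Ass)) (concat (map ((!) Ass) \<sigma>)) (concat Ass)"
proof -
  have bound: "i < length Ass" if "i \<in> set \<sigma>" for i
    using assms that by auto
  have "sum_list (map length (take i Ass)) + j < length (concat Ass)"
    if "i \<in> set \<sigma>" "j < length (Ass ! i)" for i j
    using nth_concat_bound bound that by blast
  then have "set (block_mapping \<sigma> (map length Ass)) \<subseteq> {..<length (concat Ass)}"
    using bound by (auto simp: block_mapping_def take_map
        simp del: length_concat image_add_atLeastLessThan)
  moreover have "map ((!) (concat Ass)) (block_mapping \<sigma> (map length Ass)) =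
      concat (map (\<lambda>i. map ((!) (Ass ! i)) [0..<length (Ass ! i)]) \<sigma>)"
    using bound
    by (auto simp: block_mapping_def map_concat take_map nth_concat intro!: arg_cong[of _ _ concat])
  ultimately show ?thesis
    by (simp add: reindexing_def map_nth)
qed

text \<open>The order is lexicographic, so the \<open>k\<close>-th pair names the block, and the
  place in it, of the \<open>k\<close>-th entry of a concatenation with block sizes
  \<open>ms\<close>.\<close>

definition positions :: "nat list \<Rightarrow> (nat \<times> nat) list" where
  "positions ms = concat (map (\<lambda>i. map (Pair i) [0..<ms ! i]) [0..<length ms])"

lemma set_positions: "(i, j) \<in> set (positions ms) \<longleftrightarrow> i < length ms \<and> j < ms ! i"
  by (force simp: positions_def)

text \<open>Concatenations with equal block sizes become maps over one common list and can be
  compared entry by entry.\<close>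

lemma concat_positions:
  "concat xss = map (\<lambda>(i, j). xss ! i ! j) (positions (map length xss))"
proof -
  have "concat xss = concat (map (\<lambda>i. map ((!) (xss ! i)) [0..<length (xss ! i)]) [0..<length xss])"
    by (simp add: map_nth)
  also have "\<dots> = map (\<lambda>(i, j). xss ! i ! j) (positions (map length xss))"
    unfolding positions_def map_concat map_map
    by (rule arg_cong[of _ _ concat]) auto
  finally show ?thesis .
qed

lemma offset_positions:
  "map (\<lambda>(i, j). sum_list (take i ms) + j) (positions ms) = [0..<sum_list ms]"
\<comment> \<open>Appending a block on the right leaves the offsets of all earlier blocks
  unchanged.\<close>
proof (induction ms rule: rev_induct)
  case (snoc m ms)
  have "positions (ms @ [m]) = positions ms @ map (Pair (length ms)) [0..<m]"
    by (auto simp: positions_def nth_append intro!: arg_cong[of _ _ concat])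
  then have "map (\<lambda>(i, j). sum_list (take i (ms @ [m])) + j) (positions (ms @ [m])) =
      map (\<lambda>(i, j). sum_list (take i ms) + j) (positions ms) @ map (\<lambda>j. j + sum_list ms) [0..<m]"
    by (auto simp: set_positions)
  also have "\<dots> = [0..<sum_list ms] @ [sum_list ms..<m + sum_list ms]"
    by (rule arg_cong2[of _ _ _ _ "(@)", OF snoc map_add_upt])
  also have "\<dots> = [0..<sum_list (ms @ [m])]"
    using upt_add_eq_append[of 0 "sum_list ms" m] by (simp add: add.commute)
  finally show ?case .
qed (simp add: positions_def)

text \<open>Every codomain has a single place, so the offset of the \<open>i\<close>-th block is
  \<open>i\<close> itself and each position is sent to its block number.\<close>

lemma juxtapose_replicate_zero:
  "juxtapose (map (\<lambda>m. replicate m 0) ms) (map (\<lambda>_. 1) ms) = map fst (positions ms)"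
proof -
  have "sum_list (take i (map (\<lambda>_. 1) ms)) = i" if "i < length ms" for i
    using that by (simp add: take_map sum_list_triv)
  then show ?thesis
    unfolding juxtapose_def positions_def map_concat map_map length_map
    by (intro arg_cong[of _ _ concat]) (auto simp: map_replicate_const o_def)
qed

text \<open>The inner mapping comes from \<open>q\<^sub>i\<^sub>j v\<^sub>i = \<iota>\<^sub>j id\<close>, which puts one copy of the source of \<open>v\<^sub>i\<close>, of
  length \<open>ms ! i\<close>, at each position \<open>(i, j)\<close>; the outer one identifies these copies.\<close>

lemma block_mapping_juxtapose_cancel:
  fixes ms :: "nat list"
  defines "L \<equiv> positions ms"
  shows "map ((!) (block_mapping (map fst L) ms))
      (juxtapose (map (\<lambda>(i, j). [j]) L) (map (\<lambda>(i, j). ms ! i) L)) = [0..<sum_list ms]"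
proof -
  \<comment> \<open>The list for the position \<open>(i, j)\<close> holds the flat indices of the
    whole \<open>i\<close>-th block, which is therefore repeated once for each of its
    places.\<close>
  define xss where "xss = map (\<lambda>i. map (\<lambda>k. sum_list (take i ms) + k) [0..<ms ! i]) (map fst L)"
  have lens: "map length xss = map (\<lambda>(i, j). ms ! i) L"
    by (auto simp: xss_def)
  have "juxtapose (map (\<lambda>(i, j). [j]) L) (map length xss) =
      concat (map (\<lambda>k. [sum_list (map length (take k xss)) + snd (L ! k)]) [0..<length L])"
    unfolding juxtapose_def
    by (rule arg_cong[of _ _ concat]) (auto simp: take_map split_beta)
  then have jux: "juxtapose (map (\<lambda>(i, j). [j]) L) (map (\<lambda>(i, j). ms ! i) L) =
      map (\<lambda>k. sum_list (map length (take k xss)) + snd (L ! k)) [0..<length L]"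
    by (simp only: lens concat_map_singleton)
  have block: "block_mapping (map fst L) ms = concat xss"
    by (simp only: block_mapping_def xss_def)
  \<comment> \<open>In the copy that belongs to \<open>(i, j)\<close> the \<open>j\<close>-th entry
    is chosen, which is the flat index of \<open>(i, j)\<close>; by \<open>offset_positions\<close>
    these run through all indices in order.\<close>
  have nth: "concat xss ! (sum_list (map length (take k xss)) + snd (L ! k)) =
      (\<lambda>(i, j). sum_list (take i ms) + j) (L ! k)" if k: "k < length L" for k
  proof -
    have "snd (L ! k) < ms ! fst (L ! k)"
      using nth_mem[OF k] set_positions[of "fst (L ! k)" "snd (L ! k)" ms] by (simp add: L_def)
    then show ?thesis
      using k by (subst nth_concat) (auto simp: xss_def split_beta)
  qed
  have "map ((!) (block_mapping (map fst L) ms))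
      (juxtapose (map (\<lambda>(i, j). [j]) L) (map (\<lambda>(i, j). ms ! i) L)) =
      map (\<lambda>k. (\<lambda>(i, j). sum_list (take i ms) + j) (L ! k)) [0..<length L]"
    unfolding jux block map_map by (rule map_cong) (simp_all only: o_apply nth set_upt atLeastLessThan_iff)
  also have "\<dots> = map (\<lambda>(i, j). sum_list (take i ms) + j) (map ((!) L) [0..<length L])"
    by (simp only: map_map o_def)
  also have "\<dots> = [0..<sum_list ms]"
    by (simp only: map_nth L_def offset_positions)
  finally show ?thesis .
qed

section \<open>Projections and contraction of blocks\<close>

text \<open>This is one half of an algebraic product; the other is the equation contracting u(p_1,
  ..., p_n) to the identity. This half alone yields right inverses of composition and the existence
  of tuples.\<close>

definition projections :: "('o, 'a, 'x) cart_multicat_scheme \<Rightarrow> 'a \<Rightarrow> 'a list \<Rightarrow> bool" where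
  "projections M u ps \<longleftrightarrow>
     u \<in> arr M \<and> length ps = length (src M u) \<and>
     (\<forall>i<length (src M u). ps ! i \<in> hom M [tgt M u] (src M u ! i) \<and>
       comp M (ps ! i) [u] = act M [i] (src M u) (ident M (src M u ! i)))"

context multicategory
begin

lemma hom_obj: "f \<in> hom M As B \<Longrightarrow> set As \<subseteq> obj M \<and> B \<in> obj M"
  using src_obj tgt_obj by (auto simp: hom_def)

lemma comp_unary_assoc:
  "h \<in> hom M [A] B \<Longrightarrow> composable M g fs \<Longrightarrow> tgt M g = A \<Longrightarrow>
     comp M (comp M h [g]) fs = comp M h [comp M g fs]"
  using comp_assoc[of h "[g]" "[fs]"] by (auto simp: hom_def composable_def)

end

context cartesian_multicategory
begin

lemma algebraic_product_iff:
  "algebraic_product M As C ps u \<longleftrightarrow>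
     src M u = As \<and> tgt M u = C \<and> projections M u ps \<and>
     act M (replicate (length As) 0) [C] (comp M u ps) = ident M C"
  using tgt_obj by (auto simp: algebraic_product_def projections_def hom_def)

lemma projections_composable:
  assumes "projections M u ps"
  shows "composable M u ps" "map (src M) ps = map (\<lambda>_. [tgt M u]) (src M u)"
proof -
  have len: "length ps = length (src M u)"
    using assms by (simp add: projections_def)
  have ps: "ps ! i \<in> arr M" "src M (ps ! i) = [tgt M u]" "tgt M (ps ! i) = src M u ! i"
    if "i < length (src M u)" for i
    using assms that by (auto simp: projections_def hom_def)
  show "map (src M) ps = map (\<lambda>_. [tgt M u]) (src M u)"
    by (rule nth_equalityI) (simp_all add: len ps)
  have "map (tgt M) ps = src M u"
    by (rule nth_equalityI) (simp_all add: len ps)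
  moreover have "set ps \<subseteq> arr M"
    using len ps by (auto simp: in_set_conv_nth)
  ultimately show "composable M u ps"
    using assms by (simp add: composable_def projections_def)
qed

text \<open>A copy of gamma for each v_i: the arrow v_i(q_i1, q_i2, ...) has as many inputs as
  \<open>v\<^sub>i\<close>, all equal to its target. The form as a juxtaposition fits
  \<open>comp_act_right\<close>; \<open>contraction_positions\<close> gives the form that fits
  \<open>comp_act_left\<close>.\<close>

definition contraction :: "'a list \<Rightarrow> nat list" where
  "contraction vs = juxtapose (map (\<lambda>v. replicate (length (src M v)) 0) vs) (map (\<lambda>_. 1) vs)"

lemma contraction_positions:
  "contraction vs = map fst (positions (map (\<lambda>v. length (src M v)) vs))"
  using juxtapose_replicate_zero[of "map (\<lambda>v. length (src M v)) vs"]
  by (simp add: contraction_def o_def)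

text \<open>By associativity the composite is f applied to the arrows v_i(q_i1, q_i2, ...). As the
  contraction is a juxtaposition, it moves into these arguments and makes each of them an
  identity.\<close>

lemma contract_comp:
  assumes f: "f \<in> hom M (map (tgt M) vs) B"
    and alg: "list_all2 (\<lambda>v qs. algebraic_product M (src M v) (tgt M v) qs v) vs qss"
  shows "act M (contraction vs) (map (tgt M) vs) (comp M (comp M f vs) (concat qss)) = f"
proof -
  have len: "length qss = length vs"
    using alg by (simp add: list_all2_lengthD)
  have a: "algebraic_product M (src M (vs ! i)) (tgt M (vs ! i)) (qss ! i) (vs ! i)"
    if "i < length vs" for i
    using alg that by (simp add: list_all2_conv_all_nth)
  then have p: "projections M (vs ! i) (qss ! i)" if "i < length vs" for i
    using that by (simp add: algebraic_product_iff)
  note c = projections_composable[OF p]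
  have "set vs \<subseteq> arr M"
    using p by (auto simp: in_set_conv_nth projections_def)
  then have fvs: "composable M f vs"
    using f by (simp add: composable_def hom_def)
  let ?ws = "map2 (comp M) vs qss"
  have ws: "?ws ! i \<in> hom M (map (\<lambda>_. tgt M (vs ! i)) (src M (vs ! i))) (tgt M (vs ! i))"
    if "i < length vs" for i
    using comp_hom[OF c(1)[OF that]] c(2)[OF that] that len by (simp add: concat_map_singleton)
  have lenw: "length ?ws = length vs"
    using len by simp
  have "map (tgt M) ?ws = map (tgt M) vs" "set ?ws \<subseteq> arr M"
    using ws lenw by (auto simp: hom_def in_set_conv_nth intro!: nth_equalityI)
  then have fws: "composable M f ?ws"
    using f by (simp add: composable_def hom_def)
  let ?\<sigma>s = "map (\<lambda>v. replicate (length (src M v)) 0) vs"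
  let ?Bss = "map (\<lambda>v. [tgt M v]) vs"
  have r: "set (?Bss ! i) \<subseteq> obj M \<and> reindexing (?\<sigma>s ! i) (src M (?ws ! i)) (?Bss ! i)"
    if "i < length ?ws" for i
    using ws[of i] that lenw tgt_obj[of "vs ! i"] p[of i]
    by (auto simp: reindexing_def hom_def projections_def map_replicate_const)
  have "comp M (comp M f vs) (concat qss) = comp M f ?ws"
    using comp_assoc[OF fvs len] c(1) by simp
  then have "act M (contraction vs) (map (tgt M) vs) (comp M (comp M f vs) (concat qss)) =
      act M (juxtapose ?\<sigma>s (map length ?Bss)) (concat ?Bss) (comp M f ?ws)"
    by (simp add: contraction_def o_def concat_map_singleton)
  also have "\<dots> = comp M f (map (\<lambda>i. act M (?\<sigma>s ! i) (?Bss ! i) (?ws ! i)) [0..<length ?ws])"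
    by (rule comp_act_right[symmetric, OF fws _ _ r]) (simp_all add: len)
  \<comment> \<open>Here the contraction equation of each algebraic product enters.\<close>
  also have "map (\<lambda>i. act M (?\<sigma>s ! i) (?Bss ! i) (?ws ! i)) [0..<length ?ws] =
      map (ident M) (src M f)"
    using a f len by (auto simp: algebraic_product_def hom_def intro!: nth_equalityI)
  also have "comp M f \<dots> = f"
    using f comp_ident_right[of f] by (simp add: hom_def)
  finally show ?thesis .
qed

text \<open>Moving the contraction outwards past \<open>vs\<close> turns it into a block mapping and
  leaves g applied to the arrows q_ij v_i. These are iota_j id, so their actions move outwards as
  well, and the two mappings cancel.\<close>

lemma comp_contract:
  assumes g: "g \<in> hom M (concat (map (src M) vs)) B"
    and proj: "list_all2 (projections M) vs qss"
  shows "comp M (act M (contraction vs) (map (tgt M) vs) (comp M g (concat qss))) vs = g"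
    and "act M (contraction vs) (map (tgt M) vs) (comp M g (concat qss)) \<in> hom M (map (tgt M) vs) B"
proof -
  have len: "length qss = length vs"
    using proj by (simp add: list_all2_lengthD)
  have p: "projections M (vs ! i) (qss ! i)" if "i < length vs" for i
    using proj that by (simp add: list_all2_conv_all_nth)
  \<comment> \<open>The position \<open>(i, j)\<close> stands for the \<open>j\<close>-th input of
    v_i; all lists below are rewritten as maps over \<open>L\<close>.\<close>
  define ms where "ms = map (\<lambda>v. length (src M v)) vs"
  define L where "L = positions ms"
  have ms: "ms = map length (map (src M) vs)" "ms = map length qss"
    using p len by (auto simp: ms_def projections_def intro: nth_equalityI)
  have L: "i < length vs" "j < length (src M (vs ! i))" if "(i, j) \<in> set L" for i j
    using that by (auto simp: L_def ms_def set_positions)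
  let ?As = "concat (map (src M) vs)" and ?Cs = "map (tgt M) vs" and ?Q = "concat qss"
  have As: "?As = map (\<lambda>(i, j). src M (vs ! i) ! j) L"
    using concat_positions[of "map (src M) vs"] L(1) unfolding L_def ms(1) by auto
  have Q: "?Q = map (\<lambda>(i, j). qss ! i ! j) L"
    unfolding L_def ms(2) by (rule concat_positions)
  have q: "qss ! i ! j \<in> hom M [tgt M (vs ! i)] (src M (vs ! i) ! j)"
    "comp M (qss ! i ! j) [vs ! i] =
      act M [j] (src M (vs ! i)) (ident M (src M (vs ! i) ! j))" if "(i, j) \<in> set L" for i j
    using p[OF L(1)[OF that]] L(2)[OF that] by (auto simp: projections_def)
  have gQ: "composable M g ?Q"
    using g q by (auto simp: composable_def hom_def Q As)
  have vs: "set vs \<subseteq> arr M"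
    using p by (auto simp: in_set_conv_nth projections_def)
  have Cs: "set ?Cs \<subseteq> obj M"
    using vs tgt_obj by auto
  have Aso: "set ?As \<subseteq> obj M"
    using hom_obj[OF g] by simp
  have \<sigma>: "contraction vs = map fst L"
    by (simp add: contraction_positions L_def ms_def)
  have srcQ: "concat (map (src M) ?Q) = map (\<lambda>(i, j). ?Cs ! i) L"
  proof -
    have "map (src M) ?Q = map (\<lambda>l. [(\<lambda>(i, j). ?Cs ! i) l]) L"
      using q(1) L(1) by (auto simp: Q hom_def)
    then show ?thesis
      by (simp only: concat_map_singleton)
  qed
  have gQ_hom: "comp M g ?Q \<in> hom M (map (\<lambda>(i, j). ?Cs ! i) L) B"
    using comp_hom[OF gQ] g unfolding srcQ by (simp add: hom_def)
  have r: "reindexing (map fst L) (map (\<lambda>(i, j). ?Cs ! i) L) ?Cs"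
    using L(1) by (auto simp: reindexing_def)
  show "act M (contraction vs) ?Cs (comp M g ?Q) \<in> hom M ?Cs B"
    unfolding \<sigma> by (rule act_hom[OF gQ_hom Cs r])
  \<comment> \<open>The arrow q_ij v_i has the whole source of v_i as its source, and
    \<open>\<rho>\<close> juxtaposes the injections iota_j into these sources.\<close>
  define Bss where "Bss = map (\<lambda>(i, j). src M (vs ! i)) L"
  define \<rho> where "\<rho> = juxtapose (map (\<lambda>(i, j). [j]) L) (map length Bss)"
  have "comp M (act M (contraction vs) ?Cs (comp M g ?Q)) vs =
      act M (block_mapping (map fst L) ms) ?As (comp M (comp M g ?Q) (map ((!) vs) (map fst L)))"
    unfolding \<sigma> ms_def using gQ_hom vs r by (intro comp_act_left) (auto simp: hom_def)
  \<comment> \<open>Singleton blocks let associativity pair each q_ij with its own copy of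
    v_i.\<close>
  also have "map ((!) vs) (map fst L) = concat (map (\<lambda>(i, j). [vs ! i]) L)"
    using concat_map_singleton[of "\<lambda>l. vs ! fst l" L] by (simp add: case_prod_unfold comp_def)
  also have "comp M (comp M g ?Q) \<dots> = comp M g (map2 (comp M) ?Q (map (\<lambda>(i, j). [vs ! i]) L))"
  proof (rule comp_assoc[OF gQ])
    show "length (map (\<lambda>(i, j). [vs ! i]) L) = length ?Q"
      unfolding Q by simp
  next
    fix k assume "k < length ?Q"
    then have k: "k < length L"
      unfolding Q by simp
    obtain i j where ij: "L ! k = (i, j)" by force
    then have "(i, j) \<in> set L"
      using k by (metis nth_mem)
    then show "composable M (?Q ! k) (map (\<lambda>(i, j). [vs ! i]) L ! k)"
      unfolding Q using q(1)[of i j] L(1)[of i j] vs k ij by (auto simp: composable_def hom_def)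
  qed
  \<comment> \<open>The projection equations present every argument as an action on an identity, the
    shape that \<open>comp_act_right\<close> expects.\<close>
  also have "map2 (comp M) ?Q (map (\<lambda>(i, j). [vs ! i]) L) =
      map (\<lambda>k. act M (map (\<lambda>(i, j). [j]) L ! k) (Bss ! k) (map (ident M) ?As ! k))
        [0..<length (map (ident M) ?As)]"
  proof (rule nth_equalityI)
    fix k assume "k < length (map2 (comp M) ?Q (map (\<lambda>(i, j). [vs ! i]) L))"
    then have k: "k < length L"
      unfolding Q by simp
    obtain i j where ij: "L ! k = (i, j)" by force
    then have "(i, j) \<in> set L"
      using k by (metis nth_mem)
    then show "map2 (comp M) ?Q (map (\<lambda>(i, j). [vs ! i]) L) ! k =
        map (\<lambda>k. act M (map (\<lambda>(i, j). [j]) L ! k) (Bss ! k) (map (ident M) ?As ! k))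
          [0..<length (map (ident M) ?As)] ! k"
      unfolding Q As Bss_def using q(2)[of i j] k ij by simp
  qed (simp add: Q As)
  also have "comp M g \<dots> = act M \<rho> (concat Bss) (comp M g (map (ident M) ?As))"
    unfolding \<rho>_def
  proof (rule comp_act_right)
    show "composable M g (map (ident M) ?As)"
      using ident_hom g Aso
      by (auto simp: composable_def hom_def subset_iff intro!: map_idI simp del: set_concat)
  next
    fix k assume "k < length (map (ident M) ?As)"
    then have k: "k < length L"
      unfolding As by simp
    obtain i j where ij: "L ! k = (i, j)" by force
    then have l: "(i, j) \<in> set L"
      using k by (metis nth_mem)
    have "set (src M (vs ! i)) \<subseteq> obj M"
      using L(1)[OF l] vs src_obj nth_mem by blast
    then show "set (Bss ! k) \<subseteq> obj M \<and>
        reindexing (map (\<lambda>(i, j). [j]) L ! k) (src M (map (ident M) ?As ! k)) (Bss ! k)"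
      unfolding Bss_def As using L(2)[OF l] k ij ident_hom[of "src M (vs ! i) ! j"]
      by (auto simp: reindexing_def hom_def subset_iff)
  qed (simp_all add: As Bss_def)
  also have "comp M g (map (ident M) ?As) = g"
    using comp_ident_right[of g] g by (simp add: hom_def)
  also have "act M (block_mapping (map fst L) ms) ?As (act M \<rho> (concat Bss) g) =
      act M (map ((!) (block_mapping (map fst L) ms)) \<rho>) ?As g"
  proof (rule act_act[OF g])
    have "set (src M (vs ! i)) \<subseteq> obj M" if "(i, j) \<in> set L" for i j
      using L(1)[OF that] vs src_obj nth_mem by blast
    then show "set (concat Bss) \<subseteq> obj M"
      unfolding Bss_def set_concat by fastforce
    \<comment> \<open>The repeated sources are the selection of \<open>map (src M) vs\<close> along
      the contraction, as \<open>reindexing_block_mapping\<close> expects.\<close>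
    have Bss: "Bss = map ((!) (map (src M) vs)) (map fst L)"
      using L(1) by (auto simp: Bss_def)
    show "reindexing (block_mapping (map fst L) ms) (concat Bss) ?As"
      unfolding Bss ms(1) using L(1) by (intro reindexing_block_mapping) auto
    have As': "?As = concat (map (\<lambda>(i, j). [src M (vs ! i) ! j]) L)"
      unfolding As by (simp add: case_prod_unfold)
    show "reindexing \<rho> ?As (concat Bss)"
      unfolding \<rho>_def As'
    proof (rule reindexing_juxtapose)
      fix k assume "k < length (map (\<lambda>(i, j). [src M (vs ! i) ! j]) L)"
      then have k: "k < length L"
        by simp
      obtain i j where ij: "L ! k = (i, j)" by force
      then have l: "(i, j) \<in> set L"
        using k by (metis nth_mem)
      then show "reindexing (map (\<lambda>(i, j). [j]) L ! k)
          (map (\<lambda>(i, j). [src M (vs ! i) ! j]) L ! k) (Bss ! k)"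
        using L(2)[OF l] k ij by (simp add: reindexing_def Bss_def)
    qed (simp_all add: Bss_def)
  qed (rule Aso)
  also have "map ((!) (block_mapping (map fst L) ms)) \<rho> = [0..<length ?As]"
  proof -
    have "map length Bss = map (\<lambda>(i, j). ms ! i) L"
      using L(1) by (auto simp: Bss_def ms_def)
    moreover have "sum_list ms = length ?As"
      by (simp add: ms_def length_concat o_def)
    ultimately show ?thesis
      using block_mapping_juxtapose_cancel[of ms] by (simp add: \<rho>_def L_def)
  qed
  also have "act M [0..<length ?As] ?As g = g"
    by (rule act_id[OF g])
  finally show "comp M (act M (contraction vs) ?Cs (comp M g ?Q)) vs = g" .
qed

section \<open>Preuniversal arrows and representability\<close>

text \<open>Contraction after composition with the projections is a two-sided inverse. A single
  arrow gives preuniversality of algebraic products; longer lists give closure under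
  composition.\<close>

lemma bij_betw_comp_algebraic:
  assumes alg: "list_all2 (\<lambda>v qs. algebraic_product M (src M v) (tgt M v) qs v) vs qss"
  shows "bij_betw (\<lambda>f. comp M f vs) (hom M (map (tgt M) vs) B) (hom M (concat (map (src M) vs)) B)"
proof (rule bij_betw_byWitness[where
      f' = "\<lambda>g. act M (contraction vs) (map (tgt M) vs) (comp M g (concat qss))"])
  have proj: "list_all2 (projections M) vs qss"
    using alg by (rule list_all2_mono) (simp add: algebraic_product_iff)
  then have "set vs \<subseteq> arr M"
    by (auto simp: list_all2_conv_all_nth in_set_conv_nth projections_def)
  then show "(\<lambda>f. comp M f vs) ` hom M (map (tgt M) vs) B \<subseteq> hom M (concat (map (src M) vs)) B"
    using comp_hom[of _ vs] by (auto simp: hom_def composable_def)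
  show "\<forall>f\<in>hom M (map (tgt M) vs) B.
      act M (contraction vs) (map (tgt M) vs) (comp M (comp M f vs) (concat qss)) = f"
    using contract_comp[OF _ alg] by blast
  show "\<forall>g\<in>hom M (concat (map (src M) vs)) B.
      comp M (act M (contraction vs) (map (tgt M) vs) (comp M g (concat qss))) vs = g"
    using comp_contract(1)[OF _ proj] by blast
  show "(\<lambda>g. act M (contraction vs) (map (tgt M) vs) (comp M g (concat qss))) `
      hom M (concat (map (src M) vs)) B \<subseteq> hom M (map (tgt M) vs) B"
    using comp_contract(2)[OF _ proj] by blast
qed

lemma contraction_singleton: "contraction [u] = replicate (length (src M u)) 0"
  by (simp add: contraction_def juxtapose_def)

lemma algebraic_product_preuniversal:
  assumes "algebraic_product M As C ps u"
  shows "preuniversal M u"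
  using bij_betw_comp_algebraic[of "[u]" "[ps]"] assms
  by (auto simp: preuniversal_def algebraic_product_iff projections_def)

lemma preuniversal_algebraic_product:
  assumes u: "preuniversal M u"
  obtains ps where "algebraic_product M (src M u) (tgt M u) ps u"
proof -
  have arr: "u \<in> arr M" and u_hom: "u \<in> hom M (src M u) (tgt M u)"
    using u by (simp_all add: preuniversal_def hom_def)
  have obj: "set (src M u) \<subseteq> obj M" "tgt M u \<in> obj M"
    using hom_obj[OF u_hom] by auto
  \<comment> \<open>Surjectivity of composition with \<open>u\<close>, applied to iota_i id,
    produces the projection.\<close>
  have "\<exists>p. p \<in> hom M [tgt M u] (src M u ! i) \<and>
      comp M p [u] = act M [i] (src M u) (ident M (src M u ! i))"
    if i: "i < length (src M u)" for i
  proof -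
    have A: "src M u ! i \<in> obj M"
      using i obj(1) nth_mem by blast
    have "act M [i] (src M u) (ident M (src M u ! i)) \<in> hom M (src M u) (src M u ! i)"
      using i by (intro act_hom[OF ident_hom[OF A] obj(1)]) (simp add: reindexing_def)
    then show ?thesis
      using u A unfolding preuniversal_def bij_betw_def by force
  qed
  then obtain p where p: "\<And>i. i < length (src M u) \<Longrightarrow> p i \<in> hom M [tgt M u] (src M u ! i) \<and>
      comp M (p i) [u] = act M [i] (src M u) (ident M (src M u ! i))"
    by metis
  define ps where "ps = map p [0..<length (src M u)]"
  have proj: "projections M u ps"
    using arr p by (simp add: projections_def ps_def)
  \<comment> \<open>Taking \<open>u\<close> itself for g in \<open>comp_contract\<close> gives t u =
    u = id u, and injectivity of composition with \<open>u\<close> makes t the identity.\<close>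
  let ?t = "act M (contraction [u]) [tgt M u] (comp M u ps)"
  have "comp M ?t [u] = u" "?t \<in> hom M [tgt M u] (tgt M u)"
    using comp_contract[of u "[u]" "tgt M u" "[ps]"] proj u_hom by auto
  moreover have "comp M (ident M (tgt M u)) [u] = u"
    using arr by (rule comp_ident_left)
  moreover have "inj_on (\<lambda>f. comp M f [u]) (hom M [tgt M u] (tgt M u))"
    using u obj(2) by (auto simp: preuniversal_def bij_betw_def)
  ultimately have "?t = ident M (tgt M u)"
    using ident_hom[OF obj(2)] by (metis inj_onD)
  then have "algebraic_product M (src M u) (tgt M u) ps u"
    using proj by (simp add: algebraic_product_iff contraction_singleton)
  then show thesis
    by (rule that)
qed

text \<open>Composition with u(v_1, ..., v_m) is composition with u followed by composition with the
  list \<open>vs\<close>. The second map is bijective because each preuniversal v_i carries an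
  algebraic product.\<close>

lemma preuniversal_comp:
  assumes u: "preuniversal M u" and vs: "\<And>v. v \<in> set vs \<Longrightarrow> preuniversal M v"
    and tgt: "map (tgt M) vs = src M u"
  shows "preuniversal M (comp M u vs)"
proof -
  have "\<exists>qs. algebraic_product M (src M v) (tgt M v) qs v" if "v \<in> set vs" for v
    using vs[OF that] preuniversal_algebraic_product by blast
  then obtain q where "\<And>v. v \<in> set vs \<Longrightarrow> algebraic_product M (src M v) (tgt M v) (q v) v"
    by metis
  then have alg: "list_all2 (\<lambda>v qs. algebraic_product M (src M v) (tgt M v) qs v) vs (map q vs)"
    by (simp add: list_all2_conv_all_nth)
  have uvs: "composable M u vs"
    using u vs tgt by (auto simp: composable_def preuniversal_def)
  have w: "comp M u vs \<in> hom M (concat (map (src M) vs)) (tgt M u)"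
    by (rule comp_hom[OF uvs])
  have "bij_betw (\<lambda>h. comp M h [comp M u vs]) (hom M [tgt M u] B) (hom M (concat (map (src M) vs)) B)"
    if B: "B \<in> obj M" for B
  proof -
    have "bij_betw ((\<lambda>f. comp M f vs) \<circ> (\<lambda>h. comp M h [u]))
        (hom M [tgt M u] B) (hom M (concat (map (src M) vs)) B)"
      using u B bij_betw_comp_algebraic[OF alg, of B] tgt
      by (intro bij_betw_trans) (auto simp: preuniversal_def)
    then show ?thesis
      by (rule bij_betw_cong[THEN iffD1, rotated]) (simp add: comp_unary_assoc[OF _ uvs])
  qed
  then show ?thesis
    using w by (simp add: preuniversal_def hom_def)
qed

lemma has_algebraic_products_representable:
  assumes "has_algebraic_products M"
  shows "representable M"
  unfolding representable_def
proof (intro conjI allI impI)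
  fix As assume "set As \<subseteq> obj M"
  then obtain C ps u where "algebraic_product M As C ps u"
    using assms by (auto simp: has_algebraic_products_def)
  then show "\<exists>u. src M u = As \<and> preuniversal M u"
    using algebraic_product_preuniversal algebraic_product_iff by blast
next
  fix u us
  assume "preuniversal M u \<and> (\<forall>v\<in>set us. preuniversal M v) \<and> map (tgt M) us = src M u"
  then show "preuniversal M (comp M u us)"
    by (intro preuniversal_comp) auto
qed

section \<open>Tuples and universal products\<close>

text \<open>All copies of \<open>Xs\<close> in the source of u(f_1, ..., f_n) are identified place
  by place. \<open>Xs\<close> is a parameter because an empty \<open>fs\<close> does not determine
  it.\<close>

definition tupling :: "'a \<Rightarrow> 'o list \<Rightarrow> 'a list \<Rightarrow> 'a" where
  "tupling u Xs fs =
     act M (concat (replicate (length fs) [0..<length Xs])) Xs (comp M u fs)"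

text \<open>The action commutes with composition by p_i, and p_i u = iota_i id selects f_i along the
  inclusion of the \<open>i\<close>-th copy of \<open>Xs\<close>; identifying the copies undoes this
  inclusion.\<close>

lemma tupling_projections:
  assumes proj: "projections M u ps" and Xs: "set Xs \<subseteq> obj M"
    and len: "length fs = length (src M u)"
    and fs: "\<And>i. i < length fs \<Longrightarrow> fs ! i \<in> hom M Xs (src M u ! i)"
  shows "tupling u Xs fs \<in> hom M Xs (tgt M u)"
    and "i < length fs \<Longrightarrow> comp M (ps ! i) [tupling u Xs fs] = fs ! i"
proof -
  let ?n = "length fs" and ?k = "length Xs"
  let ?\<sigma> = "concat (replicate ?n [0..<?k])"
  have u: "u \<in> arr M"
    using proj by (simp add: projections_def)
  have arr: "set fs \<subseteq> arr M"
    using fs by (auto simp: in_set_conv_nth hom_def)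
  have tgt: "map (tgt M) fs = src M u"
    using fs len by (auto simp: hom_def intro: nth_equalityI)
  have src: "map (src M) fs = replicate ?n Xs"
    using fs by (auto simp: hom_def intro: nth_equalityI)
  have ufs: "composable M u fs"
    using u arr tgt by (simp add: composable_def)
  have w: "comp M u fs \<in> hom M (concat (replicate ?n Xs)) (tgt M u)"
    using comp_hom[OF ufs] by (simp add: src)
  have r: "reindexing ?\<sigma> (concat (replicate ?n Xs)) Xs"
    by (auto simp: reindexing_def map_concat map_nth)
  show "tupling u Xs fs \<in> hom M Xs (tgt M u)"
    unfolding tupling_def by (rule act_hom[OF w Xs r])
  assume i: "i < length fs"
  let ?\<tau> = "block_mapping [i] (replicate ?n ?k)"
  have p: "ps ! i \<in> hom M [tgt M u] (src M u ! i)"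
    "comp M (ps ! i) [u] = act M [i] (src M u) (ident M (src M u ! i))"
    using proj i len by (auto simp: projections_def)
  have A: "src M u ! i \<in> obj M"
    using hom_obj[OF p(1)] by simp
  have "comp M (ps ! i) [tupling u Xs fs] =
      act M (juxtapose [?\<sigma>] (map length [Xs])) (concat [Xs]) (comp M (ps ! i) [comp M u fs])"
    using comp_act_right[of "ps ! i" "[comp M u fs]" "[?\<sigma>]" "[Xs]"] p(1) w r Xs
    by (simp add: tupling_def composable_def hom_def)
  also have "\<dots> = act M ?\<sigma> Xs (comp M (ps ! i) [comp M u fs])"
    by (simp add: juxtapose_def map_idI)
  also have "comp M (ps ! i) [comp M u fs] =
      comp M (act M [i] (map (tgt M) fs) (ident M (src M u ! i))) fs"
    using comp_unary_assoc[OF p(1) ufs] p(2) tgt by simp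
  also have "\<dots> = act M (block_mapping [i] (map (\<lambda>f. length (src M f)) fs)) (concat (map (src M) fs))
      (comp M (ident M (src M u ! i)) (map ((!) fs) [i]))"
    using ident_hom[OF A] arr i len tgt
    by (intro comp_act_left) (auto simp: hom_def reindexing_def)
  also have "comp M (ident M (src M u ! i)) (map ((!) fs) [i]) = fs ! i"
    using comp_ident_left[of "fs ! i"] fs[OF i] by (simp add: hom_def)
  also have "map (\<lambda>f. length (src M f)) fs = replicate ?n ?k"
    using arg_cong[OF src, of "map length"] by (simp add: o_def)
  also have "act M ?\<sigma> Xs (act M ?\<tau> (concat (map (src M) fs)) (fs ! i)) =
      act M (map ((!) ?\<sigma>) ?\<tau>) Xs (fs ! i)"
    unfolding src
  proof (rule act_act[OF fs[OF i] _ Xs _ r])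
    show "set (concat (replicate ?n Xs)) \<subseteq> obj M"
      using Xs by auto
    show "reindexing ?\<tau> Xs (concat (replicate ?n Xs))"
      using reindexing_block_mapping[of "[i]" "replicate ?n Xs"] i by simp
  qed
  \<comment> \<open>\<open>reindexing_block_mapping\<close> is used with copies of the index list
    \<open>[0..<?k]\<close> as blocks, so that its lookup equation is the desired composite.\<close>
  also have "map ((!) ?\<sigma>) ?\<tau> = [0..<?k]"
    using reindexing_block_mapping[of "[i]" "replicate ?n [0..<?k]"] i
    by (simp add: reindexing_def)
  also have "act M [0..<?k] Xs (fs ! i) = fs ! i"
    by (rule act_id[OF fs[OF i]])
  finally show "comp M (ps ! i) [tupling u Xs fs] = fs ! i" .
qed

text \<open>Write t as id t, replace id by the contraction of u(p_1, ..., p_n), and move the action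
  outside: what remains is the tuple of the p_i t. Uniqueness in the universal property
  follows.\<close>

lemma tupling_eta:
  assumes alg: "algebraic_product M As C ps u" and t: "t \<in> hom M Xs C"
  shows "tupling u Xs (map (\<lambda>p. comp M p [t]) ps) = t"
proof -
  let ?n = "length ps"
  have n: "length As = ?n" and proj: "projections M u ps" and C: "tgt M u = C" "C \<in> obj M"
    using alg by (auto simp: algebraic_product_iff projections_def intro: tgt_obj)
  note c = projections_composable[OF proj]
  have src_ps: "concat (map (src M) ps) = replicate ?n C"
    using alg n by (simp add: c(2) algebraic_product_iff concat_map_singleton map_replicate_const)
  have ups: "comp M u ps \<in> hom M (replicate ?n C) C"
    using comp_hom[OF c(1)] C src_ps by simp
  have "t = comp M (act M (replicate ?n 0) (map (tgt M) [t]) (comp M u ps)) [t]"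
    using alg t n comp_ident_left[of t] by (simp add: algebraic_product_def hom_def)
  also have "\<dots> = act M (block_mapping (replicate ?n 0) (map (\<lambda>g. length (src M g)) [t]))
      (concat (map (src M) [t])) (comp M (comp M u ps) (map ((!) [t]) (replicate ?n 0)))"
    using t ups by (intro comp_act_left) (auto simp: hom_def reindexing_def)
  \<comment> \<open>The constant mapping repeats the only block, the places of \<open>Xs\<close>,
    once per projection, which is the mapping used by \<open>tupling\<close>.\<close>
  also have "block_mapping (replicate ?n 0) (map (\<lambda>g. length (src M g)) [t]) =
      concat (replicate ?n [0..<length Xs])"
    using t by (simp add: block_mapping_def hom_def map_replicate_const map_idI)
  also have "concat (map (src M) [t]) = Xs"
    using t by (simp add: hom_def)
  also have "map ((!) [t]) (replicate ?n 0) = concat (map (\<lambda>p. [t]) ps)"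
    by (simp add: map_replicate_const)
  also have "comp M (comp M u ps) (concat (map (\<lambda>p. [t]) ps)) =
      comp M u (map2 (comp M) ps (map (\<lambda>p. [t]) ps))"
  proof (rule comp_assoc[OF c(1)])
    fix i assume i: "i < length ps"
    then have "ps ! i \<in> hom M [C] (As ! i)"
      using alg by (simp add: algebraic_product_def)
    then show "composable M (ps ! i) (map (\<lambda>p. [t]) ps ! i)"
      using i t by (simp add: composable_def hom_def)
  qed simp
  also have "map2 (comp M) ps (map (\<lambda>p. [t]) ps) = map (\<lambda>p. comp M p [t]) ps"
    by (auto intro: nth_equalityI)
  finally show ?thesis
    by (simp add: tupling_def)
qed

lemma algebraic_product_universal_product:
  assumes alg: "algebraic_product M As C ps u"
  shows "universal_product M As C ps"
proof -
  have u: "src M u = As" "tgt M u = C" "projections M u ps"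
    using alg by (auto simp: algebraic_product_iff)
  have "\<exists>!t. t \<in> hom M Xs C \<and> (\<forall>i<length As. comp M (ps ! i) [t] = fs ! i)"
    if Xs: "set Xs \<subseteq> obj M" and len: "length fs = length As"
      and fs: "\<forall>i<length As. fs ! i \<in> hom M Xs (As ! i)" for Xs fs
  proof (rule ex1I[of _ "tupling u Xs fs"])
    show "tupling u Xs fs \<in> hom M Xs C \<and>
        (\<forall>i<length As. comp M (ps ! i) [tupling u Xs fs] = fs ! i)"
      using tupling_projections[OF u(3) Xs, of fs] len fs u by simp
    fix t assume t: "t \<in> hom M Xs C \<and> (\<forall>i<length As. comp M (ps ! i) [t] = fs ! i)"
    then have "map (\<lambda>p. comp M p [t]) ps = fs"
      using len alg by (auto simp: algebraic_product_def intro: nth_equalityI)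
    then show "t = tupling u Xs fs"
      using tupling_eta[OF alg] t by metis
  qed
  then show ?thesis
    using alg by (auto simp: universal_product_def algebraic_product_def)
qed

lemma universal_product_algebraic_product:
  assumes univ: "universal_product M As C ps" and As: "set As \<subseteq> obj M"
  obtains u where "algebraic_product M As C ps u"
proof -
  have C: "C \<in> obj M" and len: "length ps = length As"
    and ps: "\<And>i. i < length As \<Longrightarrow> ps ! i \<in> hom M [C] (As ! i)"
    and ex1: "\<And>Xs fs. set Xs \<subseteq> obj M \<Longrightarrow> length fs = length As \<Longrightarrow>
      (\<And>i. i < length As \<Longrightarrow> fs ! i \<in> hom M Xs (As ! i)) \<Longrightarrow>
      \<exists>!t. t \<in> hom M Xs C \<and> (\<forall>i<length As. comp M (ps ! i) [t] = fs ! i)"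
    using univ by (auto simp: universal_product_def)
  \<comment> \<open>The universal property with source \<open>As\<close> is applied to the arrows
    iota_i id, so the resulting \<open>u\<close> satisfies the projection equations.\<close>
  let ?fs = "map (\<lambda>i. act M [i] As (ident M (As ! i))) [0..<length As]"
  have "?fs ! i \<in> hom M As (As ! i)" if "i < length As" for i
    using that As act_hom[OF ident_hom, of "As ! i" As "[i]"]
    by (simp add: reindexing_def subset_iff)
  then obtain u where u: "u \<in> hom M As C"
    "\<And>i. i < length As \<Longrightarrow> comp M (ps ! i) [u] = act M [i] As (ident M (As ! i))"
    using ex1[OF As, of ?fs] by auto
  have proj: "projections M u ps"
    using u ps len by (auto simp: projections_def hom_def)
  have ps': "ps ! i \<in> hom M [C] (src M u ! i)" if "i < length ps" for i
    using ps that u(1) len by (simp add: hom_def)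
  \<comment> \<open>Over the one-element source \<open>[C]\<close> tupling is gamma. Both this arrow
    and the identity have components \<open>ps\<close>, hence they are equal.\<close>
  let ?t = "tupling u [C] ps"
  have "?t \<in> hom M [C] C" "\<And>i. i < length As \<Longrightarrow> comp M (ps ! i) [?t] = ps ! i"
    using tupling_projections[OF proj _ _ ps'] C u(1) len by (auto simp: hom_def)
  moreover have "comp M (ps ! i) [ident M C] = ps ! i" if "i < length As" for i
    using comp_ident_right[of "ps ! i"] ps[OF that] by (simp add: hom_def)
  moreover have "\<exists>!t. t \<in> hom M [C] C \<and> (\<forall>i<length As. comp M (ps ! i) [t] = ps ! i)"
    using ex1[of "[C]" ps] C len ps by simp
  ultimately have "?t = ident M C"
    using ident_hom[OF C] by blast
  moreover have "concat (replicate n [0]) = replicate n (0::nat)" for n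
    by (induction n) auto
  ultimately have "act M (replicate (length As) 0) [C] (comp M u ps) = ident M C"
    using len by (simp add: tupling_def)
  then have "algebraic_product M As C ps u"
    using proj u(1) by (simp add: algebraic_product_iff hom_def)
  then show thesis
    by (rule that)
qed

section \<open>Finite products in the category of unary arrows\<close>

text \<open>A preuniversal arrow out of \<open>As\<close> yields a universal product, whose property
  for one-element sources is that of a product in the unary category.\<close>

lemma representable_has_finite_products:
  assumes "representable M"
  shows "has_finite_products (unary_category M)"
proof -
  have obj: "cobj (unary_category M) = obj M"
    and comp: "ccomp (unary_category M) = (\<lambda>g f. comp M g [f])"
    by (simp_all add: unary_category_def)
  have "\<exists>C ps. cat_product (unary_category M) As C ps" if As: "set As \<subseteq> obj M" for As
  proof -
    obtain u where "src M u = As" "preuniversal M u"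
      using assms As by (auto simp: representable_def)
    then obtain ps where "universal_product M As (tgt M u) ps"
      using preuniversal_algebraic_product algebraic_product_universal_product by metis
    then have "cat_product (unary_category M) As (tgt M u) ps"
      unfolding cat_product_def universal_product_def chom_unary_category obj comp by simp
    then show ?thesis
      by blast
  qed
  then show ?thesis
    by (simp add: has_finite_products_def obj)
qed

end

section \<open>Preservation by functors\<close>

context cartesian_functor
begin

text \<open>Both defining equations involve only composition, actions and identities, all of which
  the functor respects.\<close>

lemma F_algebraic_product:
  assumes alg: "algebraic_product M As C ps u"
  shows "algebraic_product N (map F\<^sub>o As) (F\<^sub>o C) (map F\<^sub>a ps) (F\<^sub>a u)"
proof -
  have C: "C \<in> obj M" and len: "length ps = length As" and u: "u \<in> hom M As C"
    and ps: "\<And>i. i < length As \<Longrightarrow> ps ! i \<in> hom M [C] (As ! i)"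
    and id: "act M (replicate (length As) 0) [C] (comp M u ps) = ident M C"
    and pu: "\<And>i. i < length As \<Longrightarrow> comp M (ps ! i) [u] = act M [i] As (ident M (As ! i))"
    using alg by (auto simp: algebraic_product_def)
  have As: "set As \<subseteq> obj M"
    using M.hom_obj[OF u] by simp
  have proj: "src M u = As" "tgt M u = C" "projections M u ps"
    using alg by (auto simp: M.algebraic_product_iff)
  note c = M.projections_composable[OF proj(3)]
  have w: "comp M u ps \<in> hom M (replicate (length As) C) C"
    using M.comp_hom[OF c(1)]
    by (simp add: c(2) proj concat_map_singleton map_replicate_const)
  have r: "reindexing (replicate (length As) 0) (replicate (length As) C) [C]"
    by (auto simp: reindexing_def)
  have "act N (replicate (length As) 0) [F\<^sub>o C] (comp N (F\<^sub>a u) (map F\<^sub>a ps)) =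
      F\<^sub>a (act M (replicate (length As) 0) [C] (comp M u ps))"
    using F_act[OF w _ r] C F_comp[OF c(1)] by simp
  then have "act N (replicate (length As) 0) [F\<^sub>o C] (comp N (F\<^sub>a u) (map F\<^sub>a ps)) = ident N (F\<^sub>o C)"
    using F_ident[OF C] id by simp
  moreover have "comp N (F\<^sub>a (ps ! i)) [F\<^sub>a u] = act N [i] (map F\<^sub>o As) (ident N (F\<^sub>o (As ! i)))"
    if i: "i < length As" for i
  proof -
    have A: "As ! i \<in> obj M"
      using As i by auto
    have "comp N (F\<^sub>a (ps ! i)) [F\<^sub>a u] = F\<^sub>a (comp M (ps ! i) [u])"
      using F_comp[of "ps ! i" "[u]"] ps[OF i] u by (simp add: composable_def hom_def)
    also have "\<dots> = act N [i] (map F\<^sub>o As) (F\<^sub>a (ident M (As ! i)))"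
      using F_act[OF M.ident_hom[OF A] As, of "[i]"] i by (simp add: pu reindexing_def)
    finally show ?thesis
      using F_ident[OF A] by simp
  qed
  moreover have "F\<^sub>a (ps ! i) \<in> hom N [F\<^sub>o C] (F\<^sub>o (As ! i))" if "i < length As" for i
    using F_hom[OF ps[OF that]] by simp
  ultimately show ?thesis
    using F_obj[OF C] F_hom[OF u] len by (simp add: algebraic_product_def)
qed

text \<open>Preuniversality in \<open>N\<close> concerns all objects of \<open>N\<close>, also those
  outside the image, so it is transferred through the equational description.\<close>

lemma F_preuniversal: "preuniversal M u \<Longrightarrow> preuniversal N (F\<^sub>a u)"
  using M.preuniversal_algebraic_product F_algebraic_product N.algebraic_product_preuniversal
  by metis

lemma F_universal_product:
  assumes univ: "universal_product M As C ps"
  shows "universal_product N (map F\<^sub>o As) (F\<^sub>o C) (map F\<^sub>a ps)"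
proof -
  \<comment> \<open>The members of \<open>As\<close> are targets of the projections, hence objects,
    so \<open>As\<close> may serve as a source when the arrow \<open>u\<close> is
    constructed.\<close>
  have "As ! i \<in> obj M" if "i < length As" for i
    using univ that M.hom_obj unfolding universal_product_def by blast
  then have "set As \<subseteq> obj M"
    by (auto simp: in_set_conv_nth)
  then show ?thesis
    using M.universal_product_algebraic_product[OF univ] F_algebraic_product
      N.algebraic_product_universal_product by metis
qed

end

theorem corollary4p7:
  fixes M :: "('o, 'a) cart_multicat" and N :: "('p, 'b) cart_multicat"
  assumes "cartesian_multicategory M"
  shows "(representable M \<longrightarrow> has_finite_products (unary_category M)) \<and>
    (has_algebraic_products M \<longrightarrow> representable M) \<and>
    (\<forall>F\<^sub>o F\<^sub>a. cartesian_functor M N F\<^sub>o F\<^sub>a \<longrightarrow>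
      (\<forall>As C ps u. algebraic_product M As C ps u \<longrightarrow>
         algebraic_product N (map F\<^sub>o As) (F\<^sub>o C) (map F\<^sub>a ps) (F\<^sub>a u)) \<and>
      (\<forall>u. preuniversal M u \<longrightarrow> preuniversal N (F\<^sub>a u)) \<and>
      (\<forall>As C ps. universal_product M As C ps \<longrightarrow>
         universal_product N (map F\<^sub>o As) (F\<^sub>o C) (map F\<^sub>a ps)))"
proof (intro conjI allI impI)
  show "representable M \<Longrightarrow> has_finite_products (unary_category M)"
    by (rule cartesian_multicategory.representable_has_finite_products[OF assms])
  show "has_algebraic_products M \<Longrightarrow> representable M"
    by (rule cartesian_multicategory.has_algebraic_products_representable[OF assms])
qed (rule cartesian_functor.F_algebraic_product cartesian_functor.F_preuniversal
    cartesian_functor.F_universal_product; assumption)+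

end
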